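(* Let $p\in[1,\infty)$ with Hölder conjugate $p'$, and let $\mu_\delta\in L^1(\mathbb{R}^d)$ have support in $\overline{B_\delta(0)}$. Let $\mu_s$ and $\mu_a$ denote the symmetric and antisymmetric parts of $\mu_\delta$, with corresponding extended nonlocal operators $$\overline{\mathcal{D}}_su(x)=\int_{\mathbb{R}^d}[u(y)-u(x)]\mu_s(y-x)\chi_\Omega(x)\,dy,\qquad \overline{\mathcal{D}}_au(x)=\int_{\mathbb{R}^d}[u(y)-u(x)]\mu_a(y-x)\chi_\Omega(x)\,dy .$$ Then for any $u\in L^p(\Omega_\delta)$ and $v\in L^{p'}(\Omega_\delta)$, $$\langle\overline{\mathcal{D}}_su,v\rangle-\langle u,\overline{\mathcal{D}}_sv\rangle=\int_{\Gamma_{-\delta}}\int_{\Gamma_\delta}[u(y)v(x)-u(x)v(y)]\,\mu_s(y-x)\,dy\,dx,$$ $$\langle\overline{\mathcal{D}}_au,v\rangle+\langle u,\overline{\mathcal{D}}_av\rangle=\int_{\Gamma_{-\delta}}\int_{\Gamma_\delta}[u(y)v(x)+u(x)v(y)]\,\mu_a(y-x)\,dy\,dx,$$ and, combining these, $$\langle\overline{\mathcal{D}_\delta}u,v\rangle+\langle u,\overline{\mathcal{D}_\delta}v\rangle=\int_{\Gamma_{-\delta}}\int_{\Gamma_\delta}\Bigl([u(y)v(x)+u(x)v(y)]\,\mu_\delta(y-x)-2u(x)v(y)\,\mu_s(y-x)\Bigr)\,dy\,dx+2\langle u,\overline{\mathcal{D}}_sv\rangle.$$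
   Context: $\Omega\subseteq\mathbb{R}^d$ is open and bounded and $\delta>0$. The collar is $\Gamma_\delta=\left(\bigcup_{x\in\Omega}\overline{B_\delta(x)}\right)\setminus\Omega$, $\Omega_\delta=\Omega\cup\Gamma_\delta$, and the inner collar is $\Gamma_{-\delta}=\{x\in\Omega:\ d(x,\partial\Omega)\le\delta\}$. The symmetric and antisymmetric parts are $\mu_s(z)=\tfrac12(\mu_\delta(z)+\mu_\delta(-z))$ and $\mu_a(z)=\tfrac12(\mu_\delta(z)-\mu_\delta(-z))$; $\mu_\delta$ is real-valued. In the integrals over $\mathbb{R}^d$ defining $\overline{\mathcal{D}}_s,\overline{\mathcal{D}}_a$, only $y\in\Omega_\delta$ contribute because of the support of $\mu_\delta$. The extended nonlocal derivative with kernel $\mu_\delta$ is $\overline{\mathcal{D}_\delta}=\overline{\mathcal{D}}_s+\overline{\mathcal{D}}_a$, i.e. $\overline{\mathcal{D}_\delta}u(x)=\chi_\Omega(x)\int_{\Omega_\delta}[u(y)-u(x)]\mu_\delta(y-x)\chi_{B_\delta(x)}(y)\,dy$ for $x\in\Omega_\delta$. Functions are real-valued and $\langle u,v\rangle=\int_{\Omega_\delta}u(x)v(x)\,dx$. *)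

theory Defs
  imports "HOL-Analysis.Analysis"
begin

definition collar :: "real \<Rightarrow> 'a::euclidean_space set \<Rightarrow> 'a set" where
  "collar \<delta> \<Omega> = (\<Union>x\<in>\<Omega>. cball x \<delta>) - \<Omega>"

definition ext_domain :: "real \<Rightarrow> 'a::euclidean_space set \<Rightarrow> 'a set" where
  "ext_domain \<delta> \<Omega> = \<Omega> \<union> collar \<delta> \<Omega>"

(* infdist x {} = 0 does no harm here: for bounded open \<Omega> the frontier is empty only if \<Omega> is. *)
definition inner_collar :: "real \<Rightarrow> 'a::euclidean_space set \<Rightarrow> 'a set" where
  "inner_collar \<delta> \<Omega> = {x \<in> \<Omega>. infdist x (frontier \<Omega>) \<le> \<delta>}"

(* Representatives of the elements of L^p(S), 1 \<le> p \<le> \<infinity>; values outside S are arbitrary. *)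
definition Lp :: "ennreal \<Rightarrow> 'a::euclidean_space set \<Rightarrow> ('a \<Rightarrow> real) set" where
  "Lp p S = {f \<in> borel_measurable (lebesgue_on S).
     if p = \<infinity> then \<exists>C. AE x in lebesgue_on S. \<bar>f x\<bar> \<le> C
     else integrable (lebesgue_on S) (\<lambda>x. \<bar>f x\<bar> powr enn2real p)}"

(* Support of a function defined up to null sets: the complement of the largest open set
   on which it vanishes almost everywhere. *)
definition ess_support :: "('a::euclidean_space \<Rightarrow> real) \<Rightarrow> 'a set" where
  "ess_support f = - \<Union>{U. open U \<and> (AE z in lebesgue. z \<in> U \<longrightarrow> f z = 0)}"

definition sym_part :: "('a::euclidean_space \<Rightarrow> real) \<Rightarrow> 'a \<Rightarrow> real" where
  "sym_part \<mu> z = 1/2 * (\<mu> z + \<mu> (- z))"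

definition antisym_part :: "('a::euclidean_space \<Rightarrow> real) \<Rightarrow> 'a \<Rightarrow> real" where
  "antisym_part \<mu> z = 1/2 * (\<mu> z - \<mu> (- z))"

(* The integral over the whole space, used with the kernels sym_part \<mu> and antisym_part \<mu>. *)
definition nonlocal_op ::
    "'a::euclidean_space set \<Rightarrow> ('a \<Rightarrow> real) \<Rightarrow> ('a \<Rightarrow> real) \<Rightarrow> 'a \<Rightarrow> real" where
  "nonlocal_op \<Omega> \<kappa> u x = (LINT y|lebesgue. (u y - u x) * \<kappa> (y - x) * indicator \<Omega> x)"

definition D_sym ::
    "'a::euclidean_space set \<Rightarrow> ('a \<Rightarrow> real) \<Rightarrow> ('a \<Rightarrow> real) \<Rightarrow> 'a \<Rightarrow> real" where
  "D_sym \<Omega> \<mu> = nonlocal_op \<Omega> (sym_part \<mu>)"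

definition D_antisym ::
    "'a::euclidean_space set \<Rightarrow> ('a \<Rightarrow> real) \<Rightarrow> ('a \<Rightarrow> real) \<Rightarrow> 'a \<Rightarrow> real" where
  "D_antisym \<Omega> \<mu> = nonlocal_op \<Omega> (antisym_part \<mu>)"

definition D_ext ::
    "real \<Rightarrow> 'a::euclidean_space set \<Rightarrow> ('a \<Rightarrow> real) \<Rightarrow> ('a \<Rightarrow> real) \<Rightarrow> 'a \<Rightarrow> real" where
  "D_ext \<delta> \<Omega> \<mu> u x = indicator \<Omega> x *
     (LINT y:ext_domain \<delta> \<Omega>|lebesgue. (u y - u x) * \<mu> (y - x) * indicator (ball x \<delta>) y)"

definition pairing ::
    "'a::euclidean_space set \<Rightarrow> ('a \<Rightarrow> real) \<Rightarrow> ('a \<Rightarrow> real) \<Rightarrow> real" where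
  "pairing S u v = (LINT x:S|lebesgue. u x * v x)"

end

theory Submission imports Defs begin

text \<open>
Both sides of each formula are integrals over the product space of the same few expressions
in \<open>u\<close>, \<open>v\<close> and a kernel \<open>\<kappa>\<close> evaluated at \<open>y - x\<close>. Pairing the operator with kernel \<open>\<kappa>\<close>
gives the form \<open>b(u, v)\<close>, the integral of \<open>(u y v x - u x v x) \<kappa> (y - x)\<close> over \<open>x \<in> \<Omega>\<close> and all \<open>y\<close>.
Let \<open>\<kappa> (- z) = - s \<kappa> z\<close> with \<open>s = -1\<close> for an even and \<open>s = 1\<close> for an odd kernel. In
\<open>b(u, v) + s b(v, u)\<close> the integrand \<open>(u y v x + s u x v y) \<kappa> (y - x)\<close> changes sign when \<open>x\<close> and \<open>y\<close>
are exchanged, so \<open>\<Omega> \<times> \<Omega>\<close> contributes nothing. The term with \<open>u x v x\<close> has the factor \<open>1 + s\<close>,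
which is zero for an even kernel; for an odd one, the integral of \<open>\<kappa>\<close> is zero. What remains is
the integral over \<open>x \<in> \<Omega>\<close> and \<open>y \<notin> \<Omega>\<close> (lemma \<open>nonlocal_form_boundary_flux\<close>). Since \<open>\<kappa>\<close> vanishes at
distance \<open>\<delta>\<close> and beyond, and a segment from \<open>\<Omega>\<close> to its complement meets the frontier, only \<open>x\<close> in
the inner collar and \<open>y\<close> in the collar count (lemma \<open>near_pair_in_collars\<close>). The third formula is the
sum of the first two, because \<open>\<mu>\<close> is the sum of its symmetric and antisymmetric parts.

The analysis behind this is Fubini's theorem and the exchange of \<open>x\<close> and \<open>y\<close>, for which every single
term must be integrable on the product. Young's inequality
gives \<open>|u y v x| \<le> F y + G x\<close> with \<open>F\<close>, \<open>G\<close> integrable, and \<open>F y |\<kappa> (y - x)|\<close> is integrable by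
translation invariance (lemma \<open>split_dominated_integrable\<close>).

A second difficulty is measurability. If \<open>\<kappa>\<close> is only Lebesgue measurable, \<open>\<kappa> (y - x)\<close> need not be
measurable for the product of the \<open>\<sigma>\<close>-algebras. So \<open>u\<close>, \<open>v\<close> and \<open>\<mu>\<close> are replaced by almost everywhere
equal Borel functions; as null sets are invariant under translation and reflection, for almost every \<open>x\<close>
the integrands agree for almost every \<open>y\<close>, which keeps iterated integrals
(lemma \<open>iterated_lebesgue_integral_eq_product_integral\<close>).
\<close>

section \<open>Translations and reflections of Lebesgue measure\<close>

text \<open>One parameter \<open>c = 1\<close> or \<open>c = -1\<close> covers the three substitutions in use: \<open>y \<mapsto> y - x\<close> at fixed \<open>x\<close>,
\<open>x \<mapsto> y - x\<close> at fixed \<open>y\<close>, and \<open>z \<mapsto> - z\<close>.\<close>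

lemma lborel_distr_signed_translation:
  fixes t :: "'a::euclidean_space"
  assumes "\<bar>c\<bar> = 1"
  shows "distr lborel borel (\<lambda>x. t + c *\<^sub>R x) = (lborel :: 'a measure)"
proof -
  have "c \<noteq> 0" using assms by auto
  from lborel_affine[OF this, of t] assms show ?thesis
    by (simp add: density_1)
qed

lemma AE_lborel_signed_translation:
  fixes t :: "'a::euclidean_space"
  assumes "AE z in lborel. P z" and "\<bar>c\<bar> = 1"
  shows "AE x in lborel. P (t + c *\<^sub>R x)"
proof -
  have "AE z in distr lborel borel (\<lambda>x. t + c *\<^sub>R x). P z"
    using assms by (simp only: lborel_distr_signed_translation)
  from AE_distrD[OF _ this] show ?thesis by simp
qed

lemma integral_lborel_signed_translation:
  fixes t :: "'a::euclidean_space" and f :: "'a \<Rightarrow> real"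
  assumes "f \<in> borel_measurable borel" and "\<bar>c\<bar> = 1"
  shows "(LINT x|lborel. f (t + c *\<^sub>R x)) = (LINT x|lborel. f x)"
  using integral_distr[of "\<lambda>x. t + c *\<^sub>R x" lborel borel f] assms
  by (simp add: lborel_distr_signed_translation)

lemma integrable_lborel_signed_translation:
  fixes t :: "'a::euclidean_space" and f :: "'a \<Rightarrow> real"
  assumes "integrable lborel f" and "\<bar>c\<bar> = 1"
  shows "integrable lborel (\<lambda>x. f (t + c *\<^sub>R x))"
  using integrable_distr_eq[of "\<lambda>x. t + c *\<^sub>R x" lborel borel f] assms
  by (simp add: lborel_distr_signed_translation)

section \<open>Iterated Lebesgue integrals up to null sets\<close>

text \<open>Completeness of Lebesgue measure makes measurability pass from \<open>f\<close> to \<open>g\<close> and back; if neither is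
measurable, both integrals have the default value 0. This deals with integrands that contain
the arbitrary values of \<open>u\<close> and \<open>v\<close> outside the extended domain.\<close>

lemma integral_lebesgue_cong_AE:
  fixes f g :: "'a::euclidean_space \<Rightarrow> real"
  assumes "AE x in lborel. f x = g x"
  shows "integral\<^sup>L lebesgue f = integral\<^sup>L lebesgue g"
proof (cases "f \<in> borel_measurable lebesgue")
  case True
  have "AE x in lebesgue. f x = g x" using assms by (rule AE_completion)
  then show ?thesis using True borel_measurable_AE integral_cong_AE by blast
next
  case False
  have "AE x in lebesgue. g x = f x"
    using AE_completion[OF assms] by eventually_elim simp
  with False have "g \<notin> borel_measurable lebesgue" using borel_measurable_AE by blast
  with False show ?thesis
    using borel_measurable_integrable not_integrable_integral_eq by metis
qed

text \<open>The passage from the iterated integrals of the statement, whose integrands need not be measurable on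
the product, to product integrals of Borel functions, where Fubini's theorem applies.\<close>

lemma iterated_lebesgue_integral_eq_product_integral:
  fixes f h :: "'a::euclidean_space \<Rightarrow> 'a \<Rightarrow> real"
  assumes int: "integrable (lborel \<Otimes>\<^sub>M lborel) (\<lambda>(x, y). h x y)"
    and eq: "AE x in lborel. AE y in lborel. f x y = h x y"
  shows "(LINT x|lebesgue. LINT y|lebesgue. f x y)
    = (LINT (x, y)|(lborel \<Otimes>\<^sub>M lborel). h x y)"
proof -
  have meas: "(\<lambda>(x, y). h x y) \<in> borel_measurable (lborel \<Otimes>\<^sub>M lborel)"
    using int by (rule borel_measurable_integrable)
  then have h1: "h x \<in> borel_measurable lborel" for x
    using measurable_compose[OF measurable_Pair1' meas, of x] by simp
  have "(LINT y|lebesgue. f x y) = (LINT y|lborel. h x y)"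
    if "AE y in lborel. f x y = h x y" for x
    using integral_lebesgue_cong_AE[OF that] integral_completion[OF h1] by simp
  then have "AE x in lborel. (LINT y|lebesgue. f x y) = (LINT y|lborel. h x y)"
    using eq by auto
  then have "(LINT x|lebesgue. LINT y|lebesgue. f x y)
      = (LINT x|lebesgue. LINT y|lborel. h x y)"
    by (rule integral_lebesgue_cong_AE)
  also have "\<dots> = (LINT x|lborel. LINT y|lborel. h x y)"
    by (rule integral_completion)
      (use lborel.borel_measurable_lebesgue_integral[OF meas] in simp)
  also have "\<dots> = (LINT (x, y)|(lborel \<Otimes>\<^sub>M lborel). h x y)"
    using lborel_pair.integral_fst[OF int] .
  finally show ?thesis .
qed

section \<open>Borel versions of the data\<close>

definition borel_version ::
    "'a::euclidean_space set \<Rightarrow> ('a \<Rightarrow> real) \<Rightarrow> ('a \<Rightarrow> real) \<Rightarrow> bool" where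
  "borel_version S f f0 \<longleftrightarrow>
     f0 \<in> borel_measurable borel \<and> (AE x in lborel. x \<in> S \<longrightarrow> f x = f0 x)"

text \<open>The Borel version vanishes everywhere, not only almost everywhere, off the open ball. The sphere is a
null set, so the support in the closed ball allows this.\<close>

definition kernel_version ::
    "real \<Rightarrow> ('a::euclidean_space \<Rightarrow> real) \<Rightarrow> ('a \<Rightarrow> real) \<Rightarrow> bool" where
  "kernel_version \<delta> \<kappa> \<kappa>0 \<longleftrightarrow>
     integrable lborel \<kappa>0 \<and> (AE z in lborel. \<kappa> z = \<kappa>0 z) \<and> (\<forall>z. \<delta> \<le> norm z \<longrightarrow> \<kappa>0 z = 0)"

lemma kernel_version_add:
  assumes "kernel_version \<delta> \<kappa> \<kappa>0" and "kernel_version \<delta> \<nu> \<nu>0"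
  shows "kernel_version \<delta> (\<lambda>z. \<kappa> z + \<nu> z) (\<lambda>z. \<kappa>0 z + \<nu>0 z)"
  using assms unfolding kernel_version_def by auto

lemma kernel_version_scale:
  assumes "kernel_version \<delta> \<kappa> \<kappa>0"
  shows "kernel_version \<delta> (\<lambda>z. c * \<kappa> z) (\<lambda>z. c * \<kappa>0 z)"
  using assms unfolding kernel_version_def by auto

lemma kernel_version_reflect:
  fixes \<kappa> :: "'a::euclidean_space \<Rightarrow> real"
  assumes "kernel_version \<delta> \<kappa> \<kappa>0"
  shows "kernel_version \<delta> (\<lambda>z. \<kappa> (- z)) (\<lambda>z. \<kappa>0 (- z))"
  using assms integrable_lborel_signed_translation[of \<kappa>0 "-1" 0]
    AE_lborel_signed_translation[of "\<lambda>z. \<kappa> z = \<kappa>0 z" "-1" 0]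
  unfolding kernel_version_def by auto

lemma kernel_version_sym_part:
  assumes "kernel_version \<delta> \<mu> \<mu>0"
  shows "kernel_version \<delta> (sym_part \<mu>) (sym_part \<mu>0)"
  using kernel_version_scale[OF kernel_version_add[OF assms kernel_version_reflect[OF assms]], of "1/2"]
  by (simp add: sym_part_def[abs_def])

lemma kernel_version_antisym_part:
  assumes "kernel_version \<delta> \<mu> \<mu>0"
  shows "kernel_version \<delta> (antisym_part \<mu>) (antisym_part \<mu>0)"
  using kernel_version_scale[OF kernel_version_add[OF assms
        kernel_version_scale[OF kernel_version_reflect[OF assms], of "-1"]], of "1/2"]
  by (simp add: antisym_part_def[abs_def])

text \<open>The complement of the essential support is a union of possibly uncountably many open sets, on each of
which \<open>f\<close> vanishes almost everywhere; by Lindeloef's theorem countably many of them suffice.\<close>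

lemma AE_zero_outside_ess_support:
  "AE z in lebesgue. z \<notin> ess_support f \<longrightarrow> f z = 0"
proof -
  let ?F = "{U. open U \<and> (AE z in lebesgue. z \<in> U \<longrightarrow> f z = 0)}"
  obtain F' where F': "F' \<subseteq> ?F" "countable F'" "\<Union>F' = \<Union>?F"
    by (rule Lindelof[of ?F]) auto
  have "AE z in lebesgue. \<forall>U\<in>F'. z \<in> U \<longrightarrow> f z = 0"
    using F' by (subst AE_ball_countable) auto
  then show ?thesis
    unfolding ess_support_def F'(3)[symmetric] by eventually_elim auto
qed

lemma kernel_version_exists:
  fixes \<mu> :: "'a::euclidean_space \<Rightarrow> real"
  assumes "integrable lebesgue \<mu>" and "ess_support \<mu> \<subseteq> cball 0 \<delta>"
  obtains \<mu>0 where "kernel_version \<delta> \<mu> \<mu>0"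
proof -
  obtain m where m: "m \<in> borel_measurable lborel" "AE z in lborel. \<mu> z = m z"
    using completion_ex_borel_measurable_real borel_measurable_integrable assms(1) by blast
  define \<mu>0 where "\<mu>0 z = indicator (ball 0 \<delta>) z * m z" for z
  have "AE z in lborel. z \<notin> ess_support \<mu> \<longrightarrow> \<mu> z = 0"
    using AE_zero_outside_ess_support by (simp add: AE_completion_iff)
  moreover have "AE z in lborel. z \<notin> sphere (0::'a) \<delta>"
  proof -
    have "sphere (0::'a) \<delta> \<in> null_sets lebesgue"
      using negligible_sphere negligible_iff_null_sets by blast
    from AE_not_in[OF this] show ?thesis by (simp add: AE_completion_iff)
  qed
  ultimately have eq: "AE z in lborel. \<mu> z = \<mu>0 z"
    using m(2)
  proof eventually_elim
    case (elim z)
    then show ?case using assms(2) by (auto simp: \<mu>0_def indicator_def)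
  qed
  have meas: "\<mu>0 \<in> borel_measurable lborel"
    using m(1) by (simp add: \<mu>0_def[abs_def] borel_measurable_times borel_measurable_indicator)
  have "integrable lebesgue \<mu>0"
    by (rule integrable_cong_AE_imp[OF assms(1) measurable_completion[OF meas] AE_completion[OF eq]])
  then have "integrable lborel \<mu>0"
    using integrable_completion[OF meas] by simp
  then have "kernel_version \<delta> \<mu> \<mu>0"
    using eq unfolding kernel_version_def by (auto simp: \<mu>0_def indicator_def)
  then show thesis by (rule that)
qed

lemma kernel_version_shifted:
  fixes \<kappa> :: "'a::euclidean_space \<Rightarrow> real"
  assumes "kernel_version \<delta> \<kappa> \<kappa>0"
  shows "AE y in lborel. \<kappa> (y - x) = \<kappa>0 (y - x)"
  using AE_lborel_signed_translation[of "\<lambda>z. \<kappa> z = \<kappa>0 z" 1 "- x"] assms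
  unfolding kernel_version_def by simp

section \<open>Integrability on the product space\<close>

text \<open>The bound that Young's inequality gives for a pair of functions with conjugate exponents, without
the exponents. It is symmetric in the two functions, and on the diagonal \<open>x = y\<close> it bounds \<open>f x * g x\<close>.\<close>

definition split_dominated ::
    "('a::euclidean_space \<Rightarrow> real) \<Rightarrow> ('a \<Rightarrow> real) \<Rightarrow> bool" where
  "split_dominated f g \<longleftrightarrow> f \<in> borel_measurable borel \<and> g \<in> borel_measurable borel \<and>
     (\<exists>F G. integrable lborel F \<and> integrable lborel G \<and> (\<forall>x y. \<bar>f y * g x\<bar> \<le> F y + G x))"

lemma split_dominated_commute:
  assumes "split_dominated f g"
  shows "split_dominated g f"
proof -
  from assms obtain F G where meas: "f \<in> borel_measurable borel" "g \<in> borel_measurable borel"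
    and int: "integrable lborel F" "integrable lborel G"
    and bound: "\<And>x y. \<bar>f y * g x\<bar> \<le> F y + G x"
    unfolding split_dominated_def by blast
  have "\<forall>x y. \<bar>g y * f x\<bar> \<le> G y + F x"
    using bound by (simp add: mult.commute add.commute)
  with int have "\<exists>F G. integrable lborel F \<and> integrable lborel G \<and> (\<forall>x y. \<bar>g y * f x\<bar> \<le> F y + G x)"
    by (intro exI[of _ G] exI[of _ F] conjI)
  with meas show ?thesis unfolding split_dominated_def by (intro conjI)
qed

text \<open>Integrating in \<open>y\<close> first gives \<open>\<bar>F x\<bar>\<close> times the \<open>L\<^sup>1\<close> norm of \<open>\<kappa>\<close>, whatever \<open>x\<close> is.\<close>

lemma integrable_weight_kernel_fst:
  fixes F \<kappa> :: "'a::euclidean_space \<Rightarrow> real"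
  assumes F: "integrable lborel F" and k: "integrable lborel \<kappa>"
  shows "integrable (lborel \<Otimes>\<^sub>M lborel) (\<lambda>(x, y). F x * \<kappa> (y - x))"
proof (rule lborel_pair.Fubini_integrable)
  have Fm [measurable]: "F \<in> borel_measurable borel" and km [measurable]: "\<kappa> \<in> borel_measurable borel"
    using assms by (auto dest: borel_measurable_integrable)
  show "(\<lambda>(x, y). F x * \<kappa> (y - x)) \<in> borel_measurable (lborel \<Otimes>\<^sub>M lborel)"
    by measurable
  have "(LINT y|lborel. \<bar>\<kappa> (y - x)\<bar>) = (LINT z|lborel. \<bar>\<kappa> z\<bar>)" for x
    using integral_lborel_signed_translation[of "\<lambda>z. \<bar>\<kappa> z\<bar>" 1 "- x"] by simp
  then show "integrable lborel
      (\<lambda>x. LINT y|lborel. norm (case (x, y) of (x, y) \<Rightarrow> F x * \<kappa> (y - x)))"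
    using F by (simp add: abs_mult)
  have "integrable lborel (\<lambda>y. \<kappa> (y - x))" for x
    using integrable_lborel_signed_translation[OF k, of 1 "- x"] by simp
  then show "AE x in lborel. integrable lborel (\<lambda>y. case (x, y) of (x, y) \<Rightarrow> F x * \<kappa> (y - x))"
    by simp
qed

text \<open>Exchanging \<open>x\<close> and \<open>y\<close> replaces the kernel by its reflection.\<close>

lemma integrable_weight_kernel_snd:
  fixes F \<kappa> :: "'a::euclidean_space \<Rightarrow> real"
  assumes F: "integrable lborel F" and k: "integrable lborel \<kappa>"
  shows "integrable (lborel \<Otimes>\<^sub>M lborel) (\<lambda>(x, y). F y * \<kappa> (y - x))"
proof -
  have "integrable lborel (\<lambda>z. \<kappa> (- z))"
    using integrable_lborel_signed_translation[OF k, of "-1" 0] by simp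
  from lborel_pair.integrable_product_swap[OF integrable_weight_kernel_fst[OF F this]]
  show ?thesis by (simp add: split_beta')
qed

lemma split_dominated_integrable:
  fixes f g \<kappa> :: "'a::euclidean_space \<Rightarrow> real"
  assumes fg: "split_dominated f g" and k: "integrable lborel \<kappa>"
  shows "integrable (lborel \<Otimes>\<^sub>M lborel) (\<lambda>(x, y). f y * g x * \<kappa> (y - x))"
    and "integrable (lborel \<Otimes>\<^sub>M lborel) (\<lambda>(x, y). f x * g x * \<kappa> (y - x))"
proof -
  from fg obtain F G where FG: "integrable lborel F" "integrable lborel G"
    and fm [measurable]: "f \<in> borel_measurable borel" and gm [measurable]: "g \<in> borel_measurable borel"
    and bd: "\<And>x y. \<bar>f y * g x\<bar> \<le> F y + G x"
    unfolding split_dominated_def by blast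
  have [measurable]: "\<kappa> \<in> borel_measurable borel"
    using k by (auto dest: borel_measurable_integrable)
  have ka: "integrable lborel (\<lambda>z. \<bar>\<kappa> z\<bar>)" using k by simp
  note F1 = integrable_weight_kernel_fst[OF FG(1) ka]
  note F2 = integrable_weight_kernel_snd[OF FG(1) ka]
  note G1 = integrable_weight_kernel_fst[OF FG(2) ka]
  have le: "\<bar>a * c\<bar> \<le> \<bar>b * \<bar>c\<bar> + d * \<bar>c\<bar>\<bar>" if "\<bar>a\<bar> \<le> b + d" for a b c d :: real
  proof -
    have "\<bar>a * c\<bar> = \<bar>a\<bar> * \<bar>c\<bar>" by (rule abs_mult)
    also have "\<dots> \<le> (b + d) * \<bar>c\<bar>" using that by (rule mult_right_mono) simp
    also have "\<dots> = b * \<bar>c\<bar> + d * \<bar>c\<bar>" by (rule distrib_right)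
    finally show ?thesis by linarith
  qed
  show "integrable (lborel \<Otimes>\<^sub>M lborel) (\<lambda>(x, y). f y * g x * \<kappa> (y - x))"
    by (rule Bochner_Integration.integrable_bound[OF Bochner_Integration.integrable_add[OF F2 G1]])
      (use le[OF bd] in \<open>auto intro!: AE_I2\<close>)
  show "integrable (lborel \<Otimes>\<^sub>M lborel) (\<lambda>(x, y). f x * g x * \<kappa> (y - x))"
    by (rule Bochner_Integration.integrable_bound[OF Bochner_Integration.integrable_add[OF F1 G1]])
      (use le[OF bd] in \<open>auto intro!: AE_I2\<close>)
qed

lemma integrable_indicator_rectangle:
  fixes h :: "'a::euclidean_space \<times> 'a \<Rightarrow> real"
  assumes "integrable (lborel \<Otimes>\<^sub>M lborel) h" and "A \<in> sets borel" and "B \<in> sets borel"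
  shows "integrable (lborel \<Otimes>\<^sub>M lborel) (\<lambda>(x, y). indicator A x * indicator B y * h (x, y))"
proof -
  have "A \<times> B \<in> sets (lborel \<Otimes>\<^sub>M lborel)" using assms by auto
  from integrable_mult_indicator[OF this assms(1)] show ?thesis
    by (simp add: indicator_times split_beta' mult.assoc)
qed

section \<open>Bilinear forms\<close>

definition interaction ::
    "'a::euclidean_space set \<Rightarrow> 'a set \<Rightarrow> ('a \<Rightarrow> real) \<Rightarrow> ('a \<Rightarrow> real) \<Rightarrow> ('a \<Rightarrow> real) \<Rightarrow> real" where
  "interaction A B \<kappa> f g =
     (LINT (x, y)|(lborel \<Otimes>\<^sub>M lborel). indicator A x * indicator B y * (f y * g x * \<kappa> (y - x)))"

definition self_interaction ::
    "'a::euclidean_space set \<Rightarrow> ('a \<Rightarrow> real) \<Rightarrow> ('a \<Rightarrow> real) \<Rightarrow> ('a \<Rightarrow> real) \<Rightarrow> real" where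
  "self_interaction A \<kappa> f g =
     (LINT (x, y)|(lborel \<Otimes>\<^sub>M lborel). indicator A x * (f x * g x * \<kappa> (y - x)))"

lemma interaction_scale: "interaction A B (\<lambda>z. c * \<kappa> z) f g = c * interaction A B \<kappa> f g"
proof -
  have "(\<lambda>(x, y). indicator A x * indicator B y * (f y * g x * (c * \<kappa> (y - x))))
    = (\<lambda>p. c * (case p of (x, y) \<Rightarrow> indicator A x * indicator B y * (f y * g x * \<kappa> (y - x))))"
    by (auto simp: fun_eq_iff)
  then show ?thesis unfolding interaction_def by simp
qed

lemma integrable_interaction:
  fixes f g \<kappa> :: "'a::euclidean_space \<Rightarrow> real" and A :: "'a set"
  assumes fg: "split_dominated f g" and k: "integrable lborel \<kappa>" and A: "A \<in> sets borel"
    and B: "B \<in> sets borel"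
  shows "integrable (lborel \<Otimes>\<^sub>M lborel)
    (\<lambda>(x, y). indicator A x * indicator B y * (f y * g x * \<kappa> (y - x)))"
  using integrable_indicator_rectangle[OF split_dominated_integrable(1)[OF fg k] A B] by simp

lemma integrable_self_interaction:
  fixes f g \<kappa> :: "'a::euclidean_space \<Rightarrow> real" and A :: "'a set"
  assumes fg: "split_dominated f g" and k: "integrable lborel \<kappa>" and A: "A \<in> sets borel"
  shows "integrable (lborel \<Otimes>\<^sub>M lborel) (\<lambda>(x, y). indicator A x * (f x * g x * \<kappa> (y - x)))"
  using integrable_indicator_rectangle[OF split_dominated_integrable(2)[OF fg k] A, of UNIV] by simp

lemma interaction_split:
  fixes f g \<kappa> :: "'a::euclidean_space \<Rightarrow> real" and A :: "'a set"
  assumes fg: "split_dominated f g" and k: "integrable lborel \<kappa>" and A: "A \<in> sets borel"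
    and B: "B \<in> sets borel"
  shows "interaction A UNIV \<kappa> f g = interaction A B \<kappa> f g + interaction A (- B) \<kappa> f g"
proof -
  have "- B \<in> sets borel" using B by (rule borel_comp)
  note ints = integrable_interaction[OF fg k A B] integrable_interaction[OF fg k A this]
  have "indicator A x * (f y * g x * \<kappa> (y - x))
      = indicator A x * indicator B y * (f y * g x * \<kappa> (y - x))
        + indicator A x * indicator (- B) y * (f y * g x * \<kappa> (y - x))" for x y
    by (simp add: indicator_def)
  then show ?thesis
    using Bochner_Integration.integral_add[OF ints] by (simp add: interaction_def split_beta')
qed

lemma interaction_swap:
  fixes f g \<kappa> :: "'a::euclidean_space \<Rightarrow> real" and A :: "'a set"
  assumes fg: "split_dominated f g" and k: "integrable lborel \<kappa>" and A: "A \<in> sets borel"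
  shows "interaction A A \<kappa> f g = interaction A A (\<lambda>z. \<kappa> (- z)) g f"
  using lborel_pair.integral_product_swap[OF borel_measurable_integrable[OF integrable_interaction[OF fg k A A]]]
  unfolding interaction_def by (simp add: mult.commute mult.left_commute)

lemma interaction_add_kernel:
  fixes f g \<kappa> :: "'a::euclidean_space \<Rightarrow> real" and A :: "'a set"
  assumes fg: "split_dominated f g" and k: "integrable lborel \<kappa>" and A: "A \<in> sets borel"
    and n: "integrable lborel \<nu>" and B: "B \<in> sets borel"
  shows "interaction A B (\<lambda>z. \<kappa> z + \<nu> z) f g = interaction A B \<kappa> f g + interaction A B \<nu> f g"
proof -
  have "integrable (lborel \<Otimes>\<^sub>M lborel)
    (\<lambda>(x, y). indicator A x * indicator B y * (f y * g x * \<nu> (y - x)))"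
    using integrable_indicator_rectangle[OF split_dominated_integrable(1)[OF fg n] A B]
    by simp
  then show ?thesis
    unfolding interaction_def
    by (subst Bochner_Integration.integral_add[symmetric])
      (auto intro!: Bochner_Integration.integral_cong integrable_interaction assms simp: distrib_left)
qed

lemma self_interaction_add_kernel:
  fixes f g \<kappa> :: "'a::euclidean_space \<Rightarrow> real" and A :: "'a set"
  assumes fg: "split_dominated f g" and k: "integrable lborel \<kappa>" and A: "A \<in> sets borel"
    and n: "integrable lborel \<nu>"
  shows "self_interaction A (\<lambda>z. \<kappa> z + \<nu> z) f g = self_interaction A \<kappa> f g + self_interaction A \<nu> f g"
proof -
  have "integrable (lborel \<Otimes>\<^sub>M lborel) (\<lambda>(x, y). indicator A x * (f x * g x * \<nu> (y - x)))"
    using integrable_indicator_rectangle[OF split_dominated_integrable(2)[OF fg n] A, of UNIV]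
    by simp
  then show ?thesis
    unfolding self_interaction_def
    by (subst Bochner_Integration.integral_add[symmetric])
      (auto intro!: Bochner_Integration.integral_cong integrable_self_interaction assms simp: distrib_left)
qed

text \<open>The kernel enters only through its integral, which is zero for an odd kernel.\<close>

lemma self_interaction_odd:
  fixes f g \<kappa> :: "'a::euclidean_space \<Rightarrow> real" and A :: "'a set"
  assumes fg: "split_dominated f g" and k: "integrable lborel \<kappa>" and A: "A \<in> sets borel"
    and odd: "\<And>z. \<kappa> (- z) = - \<kappa> z"
  shows "self_interaction A \<kappa> f g = 0"
proof -
  have km: "\<kappa> \<in> borel_measurable borel" using k by (auto dest: borel_measurable_integrable)
  have "(LINT z|lborel. \<kappa> z) = (LINT z|lborel. - \<kappa> z)"
    using integral_lborel_signed_translation[OF km, of "-1" 0] by (simp add: odd)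
  then have "(LINT z|lborel. \<kappa> z) = 0" by simp
  then have "(LINT y|lborel. \<kappa> (y - x)) = 0" for x
    using integral_lborel_signed_translation[OF km, of 1 "- x"] by simp
  then show ?thesis
    unfolding self_interaction_def
    by (subst lborel_pair.integral_fst[OF integrable_self_interaction[OF fg k A], symmetric]) simp
qed

lemma self_interaction_commute: "self_interaction A \<kappa> f g = self_interaction A \<kappa> g f"
  unfolding self_interaction_def by (simp add: mult.commute)

text \<open>The pairing of the nonlocal operator with kernel \<open>\<kappa>\<close>, applied to \<open>f\<close>, with \<open>g\<close>: see the lemma
\<open>pairing_nonlocal_op\<close>. Both terms are finite separately, so the difference \<open>f y - f x\<close> may be split.\<close>

definition nonlocal_form ::
    "'a::euclidean_space set \<Rightarrow> ('a \<Rightarrow> real) \<Rightarrow> ('a \<Rightarrow> real) \<Rightarrow> ('a \<Rightarrow> real) \<Rightarrow> real" where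
  "nonlocal_form \<Omega> \<kappa> f g = interaction \<Omega> UNIV \<kappa> f g - self_interaction \<Omega> \<kappa> f g"

lemma nonlocal_form_add_kernel:
  fixes f g \<kappa> \<nu> :: "'a::euclidean_space \<Rightarrow> real"
  assumes "split_dominated f g" and "integrable lborel \<kappa>" and "integrable lborel \<nu>"
    and "\<Omega> \<in> sets borel"
  shows "nonlocal_form \<Omega> (\<lambda>z. \<kappa> z + \<nu> z) f g = nonlocal_form \<Omega> \<kappa> f g + nonlocal_form \<Omega> \<nu> f g"
  unfolding nonlocal_form_def
  using interaction_add_kernel[OF assms(1,2,4,3), of UNIV] self_interaction_add_kernel[OF assms(1,2,4,3)]
  by simp

text \<open>The core of the theorem: a nonlocal Green identity for a kernel of either parity. The sign \<open>s\<close> makes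
\<open>(f y * g x + s * f x * g y) * \<kappa> (y - x)\<close> change sign under the exchange of \<open>x\<close> and \<open>y\<close>, so that
the interaction of \<open>\<Omega>\<close> with itself cancels.\<close>

lemma nonlocal_form_boundary_flux:
  fixes f g \<kappa> :: "'a::euclidean_space \<Rightarrow> real"
  assumes fg: "split_dominated f g" and k: "integrable lborel \<kappa>" and \<Omega>: "\<Omega> \<in> sets borel"
    and s: "s = 1 \<or> s = -1" and parity: "\<And>z. \<kappa> (- z) = - s * \<kappa> z"
  shows "nonlocal_form \<Omega> \<kappa> f g + s * nonlocal_form \<Omega> \<kappa> g f
    = interaction \<Omega> (- \<Omega>) \<kappa> f g + s * interaction \<Omega> (- \<Omega>) \<kappa> g f"
proof -
  note gf = split_dominated_commute[OF fg]
  have "interaction \<Omega> \<Omega> \<kappa> f g = interaction \<Omega> \<Omega> (\<lambda>z. - s * \<kappa> z) g f"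
    using interaction_swap[OF fg k \<Omega>] by (simp only: parity)
  then have inner: "interaction \<Omega> \<Omega> \<kappa> f g + s * interaction \<Omega> \<Omega> \<kappa> g f = 0"
    using interaction_scale[of \<Omega> \<Omega> "- s"] by simp
  have self: "self_interaction \<Omega> \<kappa> f g + s * self_interaction \<Omega> \<kappa> g f = 0"
    using s
  proof
    assume "s = 1"
    with parity have "\<And>z. \<kappa> (- z) = - \<kappa> z" by simp
    from self_interaction_odd[OF fg k \<Omega> this] self_interaction_odd[OF gf k \<Omega> this]
    show ?thesis by simp
  next
    assume "s = -1"
    then show ?thesis by (simp add: self_interaction_commute[of \<Omega> \<kappa> f])
  qed
  show ?thesis
    unfolding nonlocal_form_def interaction_split[OF fg k \<Omega> \<Omega>] interaction_split[OF gf k \<Omega> \<Omega>]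
    using inner self by (simp add: algebra_simps)
qed

section \<open>The operators and the collar integrals as bilinear forms\<close>

lemma ext_domain_eq_UN_cball:
  assumes "0 \<le> \<delta>"
  shows "ext_domain \<delta> \<Omega> = (\<Union>x\<in>\<Omega>. cball x \<delta>)"
  using assms unfolding ext_domain_def collar_def by force

text \<open>The extended domain is the union of the translates of \<open>\<Omega>\<close> by vectors of norm at most \<open>\<delta>\<close>, so it is
open although it is written with closed balls.\<close>

lemma open_ext_domain:
  fixes \<Omega> :: "'a::euclidean_space set"
  assumes "open \<Omega>" and "0 \<le> \<delta>"
  shows "open (ext_domain \<delta> \<Omega>)"
proof -
  have "(\<Union>x\<in>\<Omega>. cball x \<delta>) = (\<Union>z\<in>cball 0 \<delta>. (+) z ` \<Omega>)"
  proof (intro equalityI subsetI)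
    fix y assume "y \<in> (\<Union>x\<in>\<Omega>. cball x \<delta>)"
    then obtain x where "x \<in> \<Omega>" "dist x y \<le> \<delta>" by auto
    then have "y - x \<in> cball 0 \<delta>" "y = (y - x) + x"
      by (simp_all add: dist_norm norm_minus_commute)
    with \<open>x \<in> \<Omega>\<close> show "y \<in> (\<Union>z\<in>cball 0 \<delta>. (+) z ` \<Omega>)" by blast
  next
    fix y assume "y \<in> (\<Union>z\<in>cball 0 \<delta>. (+) z ` \<Omega>)"
    then show "y \<in> (\<Union>x\<in>\<Omega>. cball x \<delta>)" by (force simp: dist_norm)
  qed
  then show ?thesis
    using assms by (auto simp: ext_domain_eq_UN_cball intro: open_translation)
qed

text \<open>The segment from \<open>x\<close> to \<open>y\<close> meets the frontier of \<open>\<Omega>\<close> in a point closer to \<open>x\<close> than \<open>\<delta>\<close>. This is why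
the outer integral may be taken over the inner collar instead of \<open>\<Omega>\<close>.\<close>

lemma near_pair_in_collars:
  fixes \<Omega> :: "'a::euclidean_space set"
  assumes "x \<in> \<Omega>" and "y \<notin> \<Omega>" and "dist x y < \<delta>"
  shows "x \<in> inner_collar \<delta> \<Omega>" and "y \<in> collar \<delta> \<Omega>"
proof -
  have "closed_segment x y \<inter> frontier \<Omega> \<noteq> {}"
    using assms by (intro connected_Int_frontier) auto
  then obtain w where "w \<in> closed_segment x y" "w \<in> frontier \<Omega>" by blast
  then have "infdist x (frontier \<Omega>) \<le> dist x w" "dist x w \<le> dist x y"
    using infdist_le[of w "frontier \<Omega>" x] dist_in_closed_segment[of w x y] by (auto simp: dist_commute)
  then show "x \<in> inner_collar \<delta> \<Omega>" using assms by (simp add: inner_collar_def)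
  show "y \<in> collar \<delta> \<Omega>" using assms by (auto simp: collar_def intro!: bexI[of _ x])
qed

text \<open>For \<open>x \<in> \<Omega>\<close> the ball around \<open>x\<close> lies in the extended domain and \<open>\<mu> (y - x)\<close> vanishes for almost every \<open>y\<close>
outside it, so the cut-offs in the extended derivative only change the integrand on a null set.\<close>

lemma D_ext_eq_nonlocal_op:
  fixes \<Omega> :: "'a::euclidean_space set"
  assumes \<delta>: "0 \<le> \<delta>" and k: "kernel_version \<delta> \<mu> \<mu>0"
  shows "D_ext \<delta> \<Omega> \<mu> u = nonlocal_op \<Omega> \<mu> u"
proof
  fix x
  show "D_ext \<delta> \<Omega> \<mu> u x = nonlocal_op \<Omega> \<mu> u x"
  proof (cases "x \<in> \<Omega>")
    case True
    have "AE y in lborel. indicator (ext_domain \<delta> \<Omega>) y *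
        ((u y - u x) * \<mu> (y - x) * indicator (ball x \<delta>) y) = (u y - u x) * \<mu> (y - x)"
      using kernel_version_shifted[OF k, of x]
    proof eventually_elim
      case (elim y)
      show ?case
      proof (cases "dist x y < \<delta>")
        case in_ball: True
        then have "y \<in> ext_domain \<delta> \<Omega>"
          using True \<delta> by (auto simp: ext_domain_eq_UN_cball intro!: bexI[of _ x])
        with in_ball show ?thesis by simp
      next
        case False
        then have "\<mu>0 (y - x) = 0"
          using k by (simp add: kernel_version_def dist_norm norm_minus_commute)
        with elim show ?thesis by simp
      qed
    qed
    from integral_lebesgue_cong_AE[OF this] True show ?thesis
      by (simp add: D_ext_def nonlocal_op_def set_lebesgue_integral_def)
  qed (simp add: D_ext_def nonlocal_op_def)
qed

text \<open>A principle for comparing the integrands of the statement with their Borel versions. Only three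
situations occur outside null sets: \<open>x \<notin> \<Omega>\<close>, where indicators vanish; \<open>x \<in> \<Omega>\<close> and \<open>y\<close> near, where both
points lie in the extended domain and all data agree; and \<open>y\<close> far, where both kernels
vanish.\<close>

lemma integrand_eq_AE:
  fixes \<Omega> :: "'a::euclidean_space set" and \<delta> :: real and u v u0 v0 \<kappa> \<kappa>0 :: "'a \<Rightarrow> real"
  assumes \<delta>: "0 \<le> \<delta>"
    and u: "borel_version (ext_domain \<delta> \<Omega>) u u0" and v: "borel_version (ext_domain \<delta> \<Omega>) v v0"
    and k: "kernel_version \<delta> \<kappa> \<kappa>0"
    and near: "\<And>x y. x \<in> \<Omega> \<Longrightarrow> dist x y < \<delta> \<Longrightarrow> \<kappa> (y - x) = \<kappa>0 (y - x) \<Longrightarrow>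
      u x = u0 x \<Longrightarrow> v x = v0 x \<Longrightarrow> u y = u0 y \<Longrightarrow> v y = v0 y \<Longrightarrow> P x y"
    and outside: "\<And>x y. x \<notin> \<Omega> \<Longrightarrow> P x y"
    and far: "\<And>x y. x \<in> \<Omega> \<Longrightarrow> \<kappa> (y - x) = 0 \<Longrightarrow> \<kappa>0 (y - x) = 0 \<Longrightarrow> \<not> dist x y < \<delta> \<Longrightarrow> P x y"
  shows "AE x in lborel. AE y in lborel. P x y"
proof -
  have eq: "AE x in lborel. x \<in> ext_domain \<delta> \<Omega> \<longrightarrow> u x = u0 x \<and> v x = v0 x"
    using u v unfolding borel_version_def by auto
  from eq show ?thesis
  proof eventually_elim
    case x: (elim x)
    show ?case
    proof (cases "x \<in> \<Omega>")
      case True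
      show ?thesis
        using eq kernel_version_shifted[OF k, of x]
      proof eventually_elim
        case y: (elim y)
        show ?case
        proof (cases "dist x y < \<delta>")
          case True
          have "x \<in> ext_domain \<delta> \<Omega>" "y \<in> ext_domain \<delta> \<Omega>"
            using True \<open>x \<in> \<Omega>\<close> \<delta> by (auto simp: ext_domain_eq_UN_cball intro!: bexI[of _ x])
          then show ?thesis using near True \<open>x \<in> \<Omega>\<close> x y by blast
        next
          case False
          then have "\<kappa>0 (y - x) = 0"
            using k by (simp add: kernel_version_def dist_norm norm_minus_commute)
          then show ?thesis using far \<open>x \<in> \<Omega>\<close> False y by simp
        qed
      qed
    qed (simp add: outside)
  qed
qed

lemma pairing_nonlocal_op:
  fixes \<Omega> :: "'a::euclidean_space set" and \<delta> :: real and u v u0 v0 \<kappa> \<kappa>0 :: "'a \<Rightarrow> real"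
  assumes \<delta>: "0 \<le> \<delta>"
    and u: "borel_version (ext_domain \<delta> \<Omega>) u u0" and v: "borel_version (ext_domain \<delta> \<Omega>) v v0"
    and k: "kernel_version \<delta> \<kappa> \<kappa>0"
    and \<Omega>: "open \<Omega>" and uv: "split_dominated u0 v0"
  shows "pairing (ext_domain \<delta> \<Omega>) (nonlocal_op \<Omega> \<kappa> u) v = nonlocal_form \<Omega> \<kappa>0 u0 v0"
proof -
  have k0: "integrable lborel \<kappa>0" using k by (simp add: kernel_version_def)
  have \<Omega>b: "\<Omega> \<in> sets borel" using \<Omega> by simp
  define h where "h x y = indicator \<Omega> x * indicator UNIV y * (u0 y * v0 x * \<kappa>0 (y - x))
      - indicator \<Omega> x * (u0 x * v0 x * \<kappa>0 (y - x))" for x y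
  have ints: "integrable (lborel \<Otimes>\<^sub>M lborel)
        (\<lambda>(x, y). indicator \<Omega> x * indicator UNIV y * (u0 y * v0 x * \<kappa>0 (y - x)))"
      "integrable (lborel \<Otimes>\<^sub>M lborel) (\<lambda>(x, y). indicator \<Omega> x * (u0 x * v0 x * \<kappa>0 (y - x)))"
    using integrable_interaction[OF uv k0 \<Omega>b, of UNIV] integrable_self_interaction[OF uv k0 \<Omega>b]
    by simp_all
  have "integrable (lborel \<Otimes>\<^sub>M lborel) (\<lambda>(x, y). h x y)"
    using Bochner_Integration.integrable_diff[OF ints] by (simp add: h_def split_beta')
  moreover have "AE x in lborel. AE y in lborel.
      indicator (ext_domain \<delta> \<Omega>) x * ((u y - u x) * \<kappa> (y - x) * indicator \<Omega> x * v x) = h x y"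
    by (rule integrand_eq_AE[OF \<delta> u v k]) (auto simp: h_def ext_domain_def algebra_simps)
  ultimately have "(LINT x|lebesgue. LINT y|lebesgue.
      indicator (ext_domain \<delta> \<Omega>) x * ((u y - u x) * \<kappa> (y - x) * indicator \<Omega> x * v x))
      = (LINT (x, y)|(lborel \<Otimes>\<^sub>M lborel). h x y)"
    by (rule iterated_lebesgue_integral_eq_product_integral)
  also have "\<dots> = nonlocal_form \<Omega> \<kappa>0 u0 v0"
    using Bochner_Integration.integral_diff[OF ints]
    by (simp add: h_def split_beta' nonlocal_form_def interaction_def self_interaction_def)
  finally show ?thesis
    by (simp add: pairing_def nonlocal_op_def set_lebesgue_integral_def)
qed

lemma pairing_commute: "pairing S u v = pairing S v u"
  unfolding pairing_def by (simp add: mult.commute)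

text \<open>Two kernels are allowed since the right-hand sides of all three formulas have this shape: \<open>\<kappa>\<close> and
\<open>\<nu>\<close> are \<open>\<mu>\<^sub>s\<close> and \<open>- \<mu>\<^sub>s\<close> in the first, \<open>\<mu>\<^sub>a\<close> twice in the second, \<open>\<mu>\<close> and \<open>\<mu> - 2 \<mu>\<^sub>s = \<mu>\<^sub>a - \<mu>\<^sub>s\<close> in
the third.\<close>

lemma collar_integral_eq_interaction:
  fixes \<Omega> :: "'a::euclidean_space set"
  assumes \<Omega>: "open \<Omega>" and \<delta>: "0 \<le> \<delta>"
    and u: "borel_version (ext_domain \<delta> \<Omega>) u u0" and v: "borel_version (ext_domain \<delta> \<Omega>) v v0"
    and uv: "split_dominated u0 v0"
    and k: "kernel_version \<delta> \<kappa> \<kappa>0" and n: "kernel_version \<delta> \<nu> \<nu>0"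
  shows "(LINT x:inner_collar \<delta> \<Omega>|lebesgue. LINT y:collar \<delta> \<Omega>|lebesgue.
      u y * v x * \<kappa> (y - x) + u x * v y * \<nu> (y - x))
    = interaction \<Omega> (- \<Omega>) \<kappa>0 u0 v0 + interaction \<Omega> (- \<Omega>) \<nu>0 v0 u0"
proof -
  note vu = split_dominated_commute[OF uv]
  have k0: "integrable lborel \<kappa>0" and n0: "integrable lborel \<nu>0"
    using k n by (simp_all add: kernel_version_def)
  have \<Omega>b: "\<Omega> \<in> sets borel" and C: "- \<Omega> \<in> sets borel" using \<Omega> by auto
  let ?h1 = "\<lambda>x y. indicator \<Omega> x * indicator (- \<Omega>) y * (u0 y * v0 x * \<kappa>0 (y - x))"
  let ?h2 = "\<lambda>x y. indicator \<Omega> x * indicator (- \<Omega>) y * (v0 y * u0 x * \<nu>0 (y - x))"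
  let ?f1 = "\<lambda>x y. indicator (inner_collar \<delta> \<Omega>) x * (indicator (collar \<delta> \<Omega>) y * (u y * v x * \<kappa> (y - x)))"
  let ?f2 = "\<lambda>x y. indicator (inner_collar \<delta> \<Omega>) x * (indicator (collar \<delta> \<Omega>) y * (u x * v y * \<nu> (y - x)))"
  note ints = integrable_interaction[OF uv k0 \<Omega>b C] integrable_interaction[OF vu n0 \<Omega>b C]
  have off: "indicator (inner_collar \<delta> \<Omega>) x = (0 :: real)" if "x \<notin> \<Omega>" for x
    using that by (simp add: inner_collar_def)
  have near: "indicator (inner_collar \<delta> \<Omega>) x * (indicator (collar \<delta> \<Omega>) y * c)
      = (indicator (- \<Omega>) y * c :: real)"
    if "x \<in> \<Omega>" "dist x y < \<delta>" for x y c
  proof (cases "y \<in> \<Omega>")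
    case True
    then show ?thesis by (simp add: collar_def)
  next
    case False
    with near_pair_in_collars[OF that(1) False that(2)] show ?thesis by simp
  qed
  have f1: "AE x in lborel. AE y in lborel. ?f1 x y = ?h1 x y"
    by (rule integrand_eq_AE[OF \<delta> u v k])
      (simp_all add: off near mult.commute)
  have f2: "AE x in lborel. AE y in lborel. ?f2 x y = ?h2 x y"
    by (rule integrand_eq_AE[OF \<delta> u v n])
      (simp_all add: off near mult.commute)
  have int: "integrable (lborel \<Otimes>\<^sub>M lborel) (\<lambda>(x, y). ?h1 x y + ?h2 x y)"
    using Bochner_Integration.integrable_add[OF ints] by (simp add: split_beta')
  have "AE x in lborel. AE y in lborel. ?f1 x y + ?f2 x y = ?h1 x y + ?h2 x y"
    using f1 f2
  proof eventually_elim
    case (elim x)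
    then show ?case by eventually_elim simp
  qed
  from iterated_lebesgue_integral_eq_product_integral[OF int this]
  have "(LINT x|lebesgue. LINT y|lebesgue. ?f1 x y + ?f2 x y)
      = interaction \<Omega> (- \<Omega>) \<kappa>0 u0 v0 + interaction \<Omega> (- \<Omega>) \<nu>0 v0 u0"
    using Bochner_Integration.integral_add[OF ints] by (simp add: interaction_def split_beta')
  then show ?thesis
    by (simp add: set_lebesgue_integral_def distrib_left[symmetric])
qed

section \<open>Conjugate exponents\<close>

text \<open>For finite \<open>p\<close> the Borel version vanishes almost everywhere outside \<open>S\<close>, which makes its power
integrable on the whole space; for \<open>p = \<infinity>\<close> it is truncated so that the bound holds everywhere.\<close>

lemma Lp_borel_version:
  fixes S :: "'a::euclidean_space set"
  assumes f: "f \<in> Lp p S" and S: "S \<in> sets borel"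
  obtains f0 where "borel_version S f f0"
    and "p \<noteq> \<infinity> \<Longrightarrow> integrable lborel (\<lambda>x. \<bar>f0 x\<bar> powr enn2real p)"
    and "p = \<infinity> \<Longrightarrow> \<exists>C. \<forall>x. \<bar>f0 x\<bar> \<le> C"
proof -
  have S': "S \<inter> space lebesgue \<in> sets lebesgue" using S by auto
  have "(\<lambda>x. indicat_real S x *\<^sub>R f x) \<in> borel_measurable lebesgue"
    using f borel_measurable_restrict_space_iff[OF S', of f] by (simp add: Lp_def)
  from completion_ex_borel_measurable_real[OF this]
  obtain m where m: "m \<in> borel_measurable borel" "AE x in lborel. indicator S x * f x = m x"
    by auto
  show thesis
  proof (cases "p = \<infinity>")
    case False
    have bv: "borel_version S f m"
      using m unfolding borel_version_def by (auto elim!: eventually_mono)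
    have "integrable (lebesgue_on S) (\<lambda>x. \<bar>f x\<bar> powr enn2real p)"
      using f False by (simp add: Lp_def)
    then have int: "integrable lebesgue (\<lambda>x. indicator S x *\<^sub>R \<bar>f x\<bar> powr enn2real p)"
      by (simp only: integrable_restrict_space[OF S'])
    have meas: "(\<lambda>x. \<bar>m x\<bar> powr enn2real p) \<in> borel_measurable lborel"
      using m(1) by simp
    have "AE x in lebesgue. indicator S x *\<^sub>R \<bar>f x\<bar> powr enn2real p = \<bar>m x\<bar> powr enn2real p"
      using AE_completion[OF m(2)]
    proof eventually_elim
      case (elim x)
      then show ?case by (cases "x \<in> S") simp_all
    qed
    then have "integrable lebesgue (\<lambda>x. \<bar>m x\<bar> powr enn2real p)"
      by (rule integrable_cong_AE_imp[OF int measurable_completion[OF meas], rotated])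
    then have "integrable lborel (\<lambda>x. \<bar>m x\<bar> powr enn2real p)"
      using integrable_completion[OF meas] by simp
    with bv False show thesis by (intro that) auto
  next
    case True
    then obtain C where "AE x in lebesgue_on S. \<bar>f x\<bar> \<le> C"
      using f by (auto simp: Lp_def)
    then have "AE x in lebesgue. x \<in> S \<longrightarrow> \<bar>f x\<bar> \<le> C"
      by (simp add: AE_restrict_space_iff[OF S'])
    then have C: "AE x in lborel. x \<in> S \<longrightarrow> \<bar>f x\<bar> \<le> C"
      by (simp add: AE_completion_iff)
    let ?f0 = "\<lambda>x. max (- \<bar>C\<bar>) (min \<bar>C\<bar> (m x))"
    have "AE x in lborel. x \<in> S \<longrightarrow> f x = ?f0 x"
      using C m(2) by eventually_elim (auto simp: max_def min_def)
    moreover have "?f0 \<in> borel_measurable borel"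
      using m(1) by (intro borel_measurable_max borel_measurable_min borel_measurable_const)
    ultimately have "borel_version S f ?f0"
      unfolding borel_version_def by (intro conjI)
    moreover have "\<bar>?f0 x\<bar> \<le> \<bar>C\<bar>" for x by linarith
    ultimately show thesis using True by (intro that) blast+
  qed
qed

text \<open>Young's inequality if both exponents are finite. If \<open>p' = \<infinity>\<close>, then \<open>p = 1\<close> and \<open>F = C \<bar>u0\<bar>\<close>, \<open>G = 0\<close>
serve, with \<open>C\<close> a bound for \<open>v0\<close>.\<close>

lemma conjugate_Lp_split_dominated:
  fixes S :: "'a::euclidean_space set"
  assumes p: "1 \<le> p" "p < \<infinity>" and conj: "1 / p + 1 / p' = 1"
    and u: "u \<in> Lp p S" and v: "v \<in> Lp p' S" and S: "S \<in> sets borel"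
  obtains u0 v0 where "borel_version S u u0" and "borel_version S v v0" and "split_dominated u0 v0"
proof -
  obtain r where r: "p = ennreal r" "1 \<le> r"
    using p by (cases p) auto
  obtain u0 where u0: "borel_version S u u0" "integrable lborel (\<lambda>x. \<bar>u0 x\<bar> powr r)"
    using Lp_borel_version[OF u S] p r by (metis enn2real_ennreal ennreal_neq_top infinity_ennreal_def
        order_trans zero_le_one)
  obtain v0 where v0: "borel_version S v v0"
      "p' \<noteq> \<infinity> \<Longrightarrow> integrable lborel (\<lambda>x. \<bar>v0 x\<bar> powr enn2real p')"
      "p' = \<infinity> \<Longrightarrow> \<exists>C. \<forall>x. \<bar>v0 x\<bar> \<le> C"
    using Lp_borel_version[OF v S] by blast
  have p_inv: "1 / p = ennreal (1 / r)"
    using r by (simp add: divide_ennreal flip: ennreal_1)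
  have "\<exists>F G. integrable lborel F \<and> integrable lborel G \<and> (\<forall>x y. \<bar>u0 y * v0 x\<bar> \<le> F y + G x)"
  proof (cases "p' = \<infinity>")
    case True
    then obtain C where C: "\<And>x. \<bar>v0 x\<bar> \<le> C" using v0(3) by blast
    have "ennreal (1 / r) = 1" using True conj p_inv by simp
    then have "r = 1" using r by simp
    have "\<forall>x y. \<bar>u0 y * v0 x\<bar> \<le> C * \<bar>u0 y\<bar> powr r + 0"
      using mult_left_mono[OF C abs_ge_zero] \<open>r = 1\<close> by (simp add: abs_mult mult.commute)
    moreover have "integrable lborel (\<lambda>y. C * \<bar>u0 y\<bar> powr r)" "integrable lborel (\<lambda>_::'a. 0 :: real)"
      using u0(2) by simp_all
    ultimately show ?thesis
      by (intro exI[of _ "\<lambda>y. C * \<bar>u0 y\<bar> powr r"] exI[of _ "\<lambda>_. 0"] conjI)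
  next
    case False
    then obtain q where q: "p' = ennreal q" "0 \<le> q" by (cases p') auto
    have "q \<noteq> 0"
    proof
      assume "q = 0"
      then have "1 / p' = \<infinity>" using q by (simp add: ennreal_divide_zero)
      with conj show False by simp
    qed
    then have "q > 0" using q by simp
    then have "1 / p' = ennreal (1 / q)" using q by (simp add: divide_ennreal flip: ennreal_1)
    with conj p_inv have "ennreal (1 / r + 1 / q) = ennreal 1"
      using r \<open>q > 0\<close> by (simp add: ennreal_plus)
    then have rq: "1 / r + 1 / q = 1"
      using r \<open>q > 0\<close> by (subst (asm) ennreal_inj) auto
    have "1 / q > 0" "1 / r > 0" using r \<open>q > 0\<close> by auto
    with rq have "1 / r < 1" "1 / q < 1" by linarith+
    then have "1 < r" "1 < q" using r \<open>q > 0\<close> by (auto simp: divide_simps split: if_splits)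
    have "integrable lborel (\<lambda>x. \<bar>v0 x\<bar> powr q)"
      using v0(2) False q by simp
    then have "integrable lborel (\<lambda>y. \<bar>u0 y\<bar> powr r / r)" "integrable lborel (\<lambda>x. \<bar>v0 x\<bar> powr q / q)"
      using u0(2) by simp_all
    moreover have "\<forall>x y. \<bar>u0 y * v0 x\<bar> \<le> \<bar>u0 y\<bar> powr r / r + \<bar>v0 x\<bar> powr q / q"
      using Youngs_inequality[OF \<open>1 < r\<close> \<open>1 < q\<close> rq abs_ge_zero abs_ge_zero] by (simp add: abs_mult)
    ultimately show ?thesis
      by (intro exI[of _ "\<lambda>y. \<bar>u0 y\<bar> powr r / r"] exI[of _ "\<lambda>x. \<bar>v0 x\<bar> powr q / q"] conjI)
  qed
  then have "split_dominated u0 v0"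
    using u0(1) v0(1) unfolding split_dominated_def borel_version_def by blast
  with u0(1) v0(1) show thesis by (rule that)
qed

section \<open>The integration by parts formulas\<close>

theorem theorem3p5:
  fixes \<Omega> :: "'a::euclidean_space set" and \<delta> :: real
    and p p' :: ennreal
    and \<mu> u v :: "'a \<Rightarrow> real"
  assumes "open \<Omega>" and "bounded \<Omega>" and "\<delta> > 0"
    and "1 \<le> p" and "p < \<infinity>" and "1 / p + 1 / p' = 1"
    and "integrable lebesgue \<mu>" and "ess_support \<mu> \<subseteq> cball 0 \<delta>"
    and "u \<in> Lp p (ext_domain \<delta> \<Omega>)" and "v \<in> Lp p' (ext_domain \<delta> \<Omega>)"
  shows "pairing (ext_domain \<delta> \<Omega>) (D_sym \<Omega> \<mu> u) v - pairing (ext_domain \<delta> \<Omega>) u (D_sym \<Omega> \<mu> v)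
      = (LINT x:inner_collar \<delta> \<Omega>|lebesgue. LINT y:collar \<delta> \<Omega>|lebesgue.
           (u y * v x - u x * v y) * sym_part \<mu> (y - x))
    \<and> pairing (ext_domain \<delta> \<Omega>) (D_antisym \<Omega> \<mu> u) v + pairing (ext_domain \<delta> \<Omega>) u (D_antisym \<Omega> \<mu> v)
      = (LINT x:inner_collar \<delta> \<Omega>|lebesgue. LINT y:collar \<delta> \<Omega>|lebesgue.
           (u y * v x + u x * v y) * antisym_part \<mu> (y - x))
    \<and> pairing (ext_domain \<delta> \<Omega>) (D_ext \<delta> \<Omega> \<mu> u) v + pairing (ext_domain \<delta> \<Omega>) u (D_ext \<delta> \<Omega> \<mu> v)
      = (LINT x:inner_collar \<delta> \<Omega>|lebesgue. LINT y:collar \<delta> \<Omega>|lebesgue.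
           (u y * v x + u x * v y) * \<mu> (y - x) - 2 * u x * v y * sym_part \<mu> (y - x))
        + 2 * pairing (ext_domain \<delta> \<Omega>) u (D_sym \<Omega> \<mu> v)"
proof -
  let ?S = "ext_domain \<delta> \<Omega>"
  have \<delta>: "0 \<le> \<delta>" using assms by simp
  have \<Omega>: "\<Omega> \<in> sets borel" and C: "- \<Omega> \<in> sets borel" using assms(1) by auto
  have S: "?S \<in> sets borel" using open_ext_domain[OF assms(1) \<delta>] by simp
  obtain \<mu>0 where \<mu>: "kernel_version \<delta> \<mu> \<mu>0"
    using kernel_version_exists[OF assms(7,8)] .
  obtain u0 v0 where u: "borel_version ?S u u0" and v: "borel_version ?S v v0"
    and uv: "split_dominated u0 v0"
    using conjugate_Lp_split_dominated[OF assms(4-6,9,10) S] .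
  note vu = split_dominated_commute[OF uv]
  note \<mu>s = kernel_version_sym_part[OF \<mu>] and \<mu>a = kernel_version_antisym_part[OF \<mu>]
  have int_s: "integrable lborel (sym_part \<mu>0)" and int_a: "integrable lborel (antisym_part \<mu>0)"
    using \<mu>s \<mu>a by (simp_all add: kernel_version_def)
  note formL = pairing_nonlocal_op[OF \<delta> u v _ assms(1) uv]
  have formR: "pairing ?S u (nonlocal_op \<Omega> \<kappa> v) = nonlocal_form \<Omega> \<kappa>0 v0 u0"
    if "kernel_version \<delta> \<kappa> \<kappa>0" for \<kappa> \<kappa>0
    using pairing_nonlocal_op[OF \<delta> v u that assms(1) vu] by (simp add: pairing_commute)
  note flux = collar_integral_eq_interaction[OF assms(1) \<delta> u v uv]
  note flux_s = nonlocal_form_boundary_flux[OF uv int_s \<Omega>, of "-1"]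
  note flux_a = nonlocal_form_boundary_flux[OF uv int_a \<Omega>, of 1]

  have sym: "pairing ?S (D_sym \<Omega> \<mu> u) v - pairing ?S u (D_sym \<Omega> \<mu> v)
      = interaction \<Omega> (- \<Omega>) (sym_part \<mu>0) u0 v0 - interaction \<Omega> (- \<Omega>) (sym_part \<mu>0) v0 u0"
    using flux_s by (simp add: D_sym_def formL[OF \<mu>s] formR[OF \<mu>s] sym_part_def)
  have anti: "pairing ?S (D_antisym \<Omega> \<mu> u) v + pairing ?S u (D_antisym \<Omega> \<mu> v)
      = interaction \<Omega> (- \<Omega>) (antisym_part \<mu>0) u0 v0 + interaction \<Omega> (- \<Omega>) (antisym_part \<mu>0) v0 u0"
    using flux_a by (simp add: D_antisym_def formL[OF \<mu>a] formR[OF \<mu>a] antisym_part_def)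

  have decomp: "\<mu>0 = (\<lambda>z. sym_part \<mu>0 z + antisym_part \<mu>0 z)"
    by (simp add: fun_eq_iff sym_part_def antisym_part_def field_simps)
  have ext: "pairing ?S (D_ext \<delta> \<Omega> \<mu> u) v + pairing ?S u (D_ext \<delta> \<Omega> \<mu> v)
      = (pairing ?S (D_sym \<Omega> \<mu> u) v + pairing ?S u (D_sym \<Omega> \<mu> v))
        + (pairing ?S (D_antisym \<Omega> \<mu> u) v + pairing ?S u (D_antisym \<Omega> \<mu> v))"
  proof -
    have "nonlocal_form \<Omega> \<mu>0 f g
        = nonlocal_form \<Omega> (sym_part \<mu>0) f g + nonlocal_form \<Omega> (antisym_part \<mu>0) f g"
      if "split_dominated f g" for f g
      by (subst decomp) (rule nonlocal_form_add_kernel[OF that int_s int_a \<Omega>])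
    from this[OF uv] this[OF vu] show ?thesis
      by (simp add: D_ext_eq_nonlocal_op[OF \<delta> \<mu>] D_sym_def D_antisym_def
          formL[OF \<mu>] formR[OF \<mu>] formL[OF \<mu>s] formR[OF \<mu>s] formL[OF \<mu>a] formR[OF \<mu>a])
  qed

  have rhs_s: "(LINT x:inner_collar \<delta> \<Omega>|lebesgue. LINT y:collar \<delta> \<Omega>|lebesgue.
        (u y * v x - u x * v y) * sym_part \<mu> (y - x))
      = interaction \<Omega> (- \<Omega>) (sym_part \<mu>0) u0 v0 - interaction \<Omega> (- \<Omega>) (sym_part \<mu>0) v0 u0"
    using flux[OF \<mu>s kernel_version_scale[OF \<mu>s, of "-1"]]
      interaction_scale[of \<Omega> "- \<Omega>" "-1"]
    by (simp add: left_diff_distrib)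
  have rhs_a: "(LINT x:inner_collar \<delta> \<Omega>|lebesgue. LINT y:collar \<delta> \<Omega>|lebesgue.
        (u y * v x + u x * v y) * antisym_part \<mu> (y - x))
      = interaction \<Omega> (- \<Omega>) (antisym_part \<mu>0) u0 v0 + interaction \<Omega> (- \<Omega>) (antisym_part \<mu>0) v0 u0"
    using flux[OF \<mu>a \<mu>a] by (simp add: distrib_right)
  have rhs: "(LINT x:inner_collar \<delta> \<Omega>|lebesgue. LINT y:collar \<delta> \<Omega>|lebesgue.
        (u y * v x + u x * v y) * \<mu> (y - x) - 2 * u x * v y * sym_part \<mu> (y - x))
      = (interaction \<Omega> (- \<Omega>) (sym_part \<mu>0) u0 v0 - interaction \<Omega> (- \<Omega>) (sym_part \<mu>0) v0 u0)
        + (interaction \<Omega> (- \<Omega>) (antisym_part \<mu>0) u0 v0 + interaction \<Omega> (- \<Omega>) (antisym_part \<mu>0) v0 u0)"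
  proof -
    \<comment> \<open>The coefficient of \<open>u x * v y\<close> is \<open>\<mu> - 2 \<mu>\<^sub>s = \<mu>\<^sub>a - \<mu>\<^sub>s\<close>.\<close>
    have n: "kernel_version \<delta> (\<lambda>z. antisym_part \<mu> z + -1 * sym_part \<mu> z)
        (\<lambda>z. antisym_part \<mu>0 z + -1 * sym_part \<mu>0 z)"
      by (rule kernel_version_add[OF \<mu>a kernel_version_scale[OF \<mu>s]])
    have "(u y * v x + u x * v y) * \<mu> (y - x) - 2 * u x * v y * sym_part \<mu> (y - x)
        = u y * v x * \<mu> (y - x)
          + u x * v y * (antisym_part \<mu> (y - x) + -1 * sym_part \<mu> (y - x))" for x y
      by (simp add: sym_part_def antisym_part_def field_simps)
    then have "(LINT x:inner_collar \<delta> \<Omega>|lebesgue. LINT y:collar \<delta> \<Omega>|lebesgue.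
          (u y * v x + u x * v y) * \<mu> (y - x) - 2 * u x * v y * sym_part \<mu> (y - x))
        = interaction \<Omega> (- \<Omega>) \<mu>0 u0 v0
          + interaction \<Omega> (- \<Omega>) (\<lambda>z. antisym_part \<mu>0 z + -1 * sym_part \<mu>0 z) v0 u0"
      using flux[OF \<mu> n] by simp
    moreover have "interaction \<Omega> (- \<Omega>) \<mu>0 u0 v0
        = interaction \<Omega> (- \<Omega>) (sym_part \<mu>0) u0 v0 + interaction \<Omega> (- \<Omega>) (antisym_part \<mu>0) u0 v0"
      by (subst decomp) (rule interaction_add_kernel[OF uv int_s \<Omega> int_a C])
    moreover have "interaction \<Omega> (- \<Omega>) (\<lambda>z. antisym_part \<mu>0 z + -1 * sym_part \<mu>0 z) v0 u0
        = interaction \<Omega> (- \<Omega>) (antisym_part \<mu>0) v0 u0 - interaction \<Omega> (- \<Omega>) (sym_part \<mu>0) v0 u0"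
      using interaction_add_kernel[OF vu int_a \<Omega> _ C, of "\<lambda>z. -1 * sym_part \<mu>0 z"]
        interaction_scale[of \<Omega> "- \<Omega>" "-1"] int_s by simp
    ultimately show ?thesis by simp
  qed
  show ?thesis
    using sym anti ext rhs_s rhs_a rhs by simp
qed

end
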